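(* Let $\mathbb{G}$ be a set (of goals), let $\mathscr{L}$ be a logic over $\mathbb{G}$, and let $\mathsf{L}$ be a deductive system over $\mathbb{G}$ that is sound and complete for $\mathscr{L}$. Let $\mathbb{D}$ be a finite set of reduction operators on $\mathbb{G}$, that is, partial functions $\rho:\mathbb{G}\rightharpoonup\mathcal{P}_{<\omega}(\mathbb{G})$. Then both of the following hold: (1) if $\mathbb{D}$ is faithful for $\mathsf{L}$, then $\mathbb{D}$ is sound for $\mathscr{L}$; (2) if $\mathbb{D}$ is adequate for $\mathsf{L}$, then $\mathbb{D}$ is complete for $\mathscr{L}$.
   Context: $\mathcal{P}_{<\omega}(X)$ denotes the set of finite subsets of $X$. Logic and deductive system. For present purposes a logic $\mathscr{L}$ over $\mathbb{G}$ determines which goals $G\in\mathbb{G}$ are valid in $\mathscr{L}$. A deductive system $\mathsf{L}$ over $\mathbb{G}$ is given by rules (rule instances), each leading from finitely many premisses $G_1,\ldots,G_n\in\mathbb{G}$ to a conclusion $G\in\mathbb{G}$; the case $n=0$ (axioms) is allowed. A goal $G$ admits a proof in $\mathsf{L}$ if it is the conclusion of a finite derivation tree built from rules of $\mathsf{L}$ whose leaves are all conclusions of rules with no premisses. $\mathsf{L}$ is sound for $\mathscr{L}$ if every $G\in\mathbb{G}$ that admits a proof in $\mathsf{L}$ is valid in $\mathscr{L}$; $\mathsf{L}$ is complete for $\mathscr{L}$ if every $G\in\mathbb{G}$ that is valid in $\mathscr{L}$ admits a proof in $\mathsf{L}$. Reductions. A state is a finite set of goals. A reduction operator $\rho\in\mathbb{D}$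 moves a state $S$ to a state $S'$ by replacing one goal $H\in S$ at which $\rho$ is defined by its subgoals: $S'=(S\setminus\{H\})\cup\rho(H)$. A sequence of reductions is a sequence of such steps using operators in $\mathbb{D}$. Soundness and completeness of $\mathbb{D}$. $\mathbb{D}$ is sound for $\mathscr{L}$ if, for any $G\in\mathbb{G}$, whenever the state $\{G\}$ has a (finite) sequence of reductions ending in the empty set, $G$ is valid in $\mathscr{L}$. $\mathbb{D}$ is complete for $\mathscr{L}$ if, for any $G\in\mathbb{G}$ that is valid in $\mathscr{L}$, the state $\{G\}$ has a (finite) sequence of reductions ending in the empty set. Faithfulness and adequacy. $\mathbb{D}$ is faithful for $\mathsf{L}$ if, for any $G\in\mathbb{G}$ and any $\rho\in\mathbb{D}$, if $\rho(G)=\{G_1,\ldots,G_n\}$, then there is a rule in $\mathsf{L}$ from $G_1,\ldots,G_n$ to $G$. $\mathbb{D}$ is adequate for $\mathsf{L}$ if, for any $G\in\mathbb{G}$, if there is a rule in $\mathsf{L}$ from $G_1,\ldots,G_n$ to $G$, then there is $\rho\in\mathbb{D}$ such that $\rho(G)=\{G_1,\ldots,G_n\}$. *)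

theory Defs
  imports Main
begin

text \<open>A logic over a set \<open>\<GG>\<close> of goals is represented by its set of valid goals.\<close>

type_synonym 'g logic = "'g set"

definition logic_over :: "'g set \<Rightarrow> 'g logic \<Rightarrow> bool" where
  "logic_over \<GG> V \<longleftrightarrow> V \<subseteq> \<GG>"

text \<open>A rule instance is the pair of its list of premisses and its conclusion.\<close>

type_synonym 'g rule = "'g list \<times> 'g"

definition deductive_system :: "'g set \<Rightarrow> 'g rule set \<Rightarrow> bool" where
  "deductive_system \<GG> L \<longleftrightarrow> L \<subseteq> lists \<GG> \<times> \<GG>"

datatype 'g tree = Node (concl: 'g) (subtrees: "'g tree list")

text \<open>The condition on leaves is the instance \<open>ts = []\<close>: a leaf must be the
  conclusion of a rule with no premisses.\<close>

primrec derivation :: "'g rule set \<Rightarrow> 'g tree \<Rightarrow> bool" where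
  "derivation L (Node G ts) \<longleftrightarrow> (map concl ts, G) \<in> L \<and> list_all (derivation L) ts"

definition admits_proof :: "'g rule set \<Rightarrow> 'g \<Rightarrow> bool" where
  "admits_proof L G \<longleftrightarrow> (\<exists>t. derivation L t \<and> concl t = G)"

definition sound_system :: "'g set \<Rightarrow> 'g logic \<Rightarrow> 'g rule set \<Rightarrow> bool" where
  "sound_system \<GG> V L \<longleftrightarrow> (\<forall>G\<in>\<GG>. admits_proof L G \<longrightarrow> G \<in> V)"

definition complete_system :: "'g set \<Rightarrow> 'g logic \<Rightarrow> 'g rule set \<Rightarrow> bool" where
  "complete_system \<GG> V L \<longleftrightarrow> (\<forall>G\<in>\<GG>. G \<in> V \<longrightarrow> admits_proof L G)"

text \<open>\<open>Fpow \<GG>\<close> is the set of finite subsets of \<open>\<GG>\<close>, i.e. the set of states.\<close>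

type_synonym 'g operator = "'g \<rightharpoonup> 'g set"

definition reduction_operator :: "'g set \<Rightarrow> 'g operator \<Rightarrow> bool" where
  "reduction_operator \<GG> \<rho> \<longleftrightarrow> dom \<rho> \<subseteq> \<GG> \<and> ran \<rho> \<subseteq> Fpow \<GG>"

definition reduction_step :: "'g set \<Rightarrow> 'g operator set \<Rightarrow> 'g set \<Rightarrow> 'g set \<Rightarrow> bool" where
  "reduction_step \<GG> D S S' \<longleftrightarrow>
     S \<in> Fpow \<GG> \<and> (\<exists>\<rho>\<in>D. \<exists>H\<in>S. \<exists>P. \<rho> H = Some P \<and> S' = (S - {H}) \<union> P)"

definition reduces_to :: "'g set \<Rightarrow> 'g operator set \<Rightarrow> 'g set \<Rightarrow> 'g set \<Rightarrow> bool" where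
  "reduces_to \<GG> D = (reduction_step \<GG> D)\<^sup>*\<^sup>*"

definition sound_operators :: "'g set \<Rightarrow> 'g logic \<Rightarrow> 'g operator set \<Rightarrow> bool" where
  "sound_operators \<GG> V D \<longleftrightarrow> (\<forall>G\<in>\<GG>. reduces_to \<GG> D {G} {} \<longrightarrow> G \<in> V)"

definition complete_operators :: "'g set \<Rightarrow> 'g logic \<Rightarrow> 'g operator set \<Rightarrow> bool" where
  "complete_operators \<GG> V D \<longleftrightarrow> (\<forall>G\<in>\<GG>. G \<in> V \<longrightarrow> reduces_to \<GG> D {G} {})"

text \<open>Operators produce sets whereas rules have lists of premisses. Faithfulness asks for
  a rule for some enumeration of the set of subgoals; demanding one for every enumeration,
  with arbitrary order and repetitions, would be a stronger hypothesis.\<close>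

definition faithful :: "'g set \<Rightarrow> 'g operator set \<Rightarrow> 'g rule set \<Rightarrow> bool" where
  "faithful \<GG> D L \<longleftrightarrow>
     (\<forall>G\<in>\<GG>. \<forall>\<rho>\<in>D. \<forall>P. \<rho> G = Some P \<longrightarrow> (\<exists>Gs. set Gs = P \<and> (Gs, G) \<in> L))"

definition adequate :: "'g set \<Rightarrow> 'g operator set \<Rightarrow> 'g rule set \<Rightarrow> bool" where
  "adequate \<GG> D L \<longleftrightarrow>
     (\<forall>G\<in>\<GG>. \<forall>Gs. (Gs, G) \<in> L \<longrightarrow> (\<exists>\<rho>\<in>D. \<rho> G = Some (set Gs)))"

end

theory Submission imports Defs begin

text \<open>Soundness holds since every goal of a state that reduces to the empty set is provable, by
  induction along the reductions. For completeness, a state is read as the set of conclusions of a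
  list of derivations. Reducing the conclusion of the first derivation replaces it by its immediate
  subderivations and discards the other derivations of the same goal, so the total size of the list
  decreases. Discarding them matches the fact that states are sets and not multisets.\<close>

text \<open>One derivation is chosen for each goal in \<open>set Gs\<close>, and these are grafted
  under a new root; repeated premisses share the same derivation.\<close>

lemma admits_proof_rule:
  assumes "(Gs, G) \<in> L" and "\<forall>H\<in>set Gs. admits_proof L H"
  shows "admits_proof L G"
proof -
  from assms(2) obtain f where f: "\<forall>H\<in>set Gs. derivation L (f H) \<and> concl (f H) = H"
    unfolding admits_proof_def by metis
  then have "map concl (map f Gs) = Gs"
    by (simp add: map_idI)
  with f assms(1) have "derivation L (Node G (map f Gs))"
    by (simp add: list_all_iff)
  then show ?thesis
    unfolding admits_proof_def by (metis tree.sel(1))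
qed

lemma concl_in_goals:
  assumes "deductive_system \<GG> L" and "derivation L t"
  shows "concl t \<in> \<GG>"
  using assms by (cases t) (auto simp: deductive_system_def)

lemma reduces_to_empty_imp_admits_proof:
  assumes "faithful \<GG> D L" and "reduces_to \<GG> D S {}" and "G \<in> S"
  shows "admits_proof L G"
proof -
  from assms(2) have "\<forall>G\<in>S. admits_proof L G"
    unfolding reduces_to_def
  proof (induction rule: converse_rtranclp_induct)
    case base
    show ?case by simp
  next
    case (step S S')
    then obtain \<rho> H P where "\<rho> \<in> D" "H \<in> S" "S \<subseteq> \<GG>" "\<rho> H = Some P"
      and S': "S' = (S - {H}) \<union> P"
      unfolding reduction_step_def Fpow_def by auto
    with assms(1) obtain Gs where "set Gs = P" "(Gs, H) \<in> L"
      unfolding faithful_def by blast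
    \<comment> \<open>Both \<open>P\<close> and \<open>S - {H}\<close> lie in \<open>S'\<close>, so
      the induction hypothesis covers the premisses of the rule and every goal of \<open>S\<close>
      except possibly \<open>H\<close>.\<close>
    with S' step.IH have "admits_proof L H"
      by (intro admits_proof_rule) auto
    with S' step.IH show ?case by auto
  qed
  with assms(3) show ?thesis by blast
qed

text \<open>Lists of derivations make the induction go through: even from a single goal, one step
  can lead to a state of several goals.\<close>

lemma derivations_reduce_to_empty:
  assumes "deductive_system \<GG> L" and "adequate \<GG> D L"
    and "list_all (derivation L) ts"
  shows "reduces_to \<GG> D (concl ` set ts) {}"
  using assms(3)
proof (induction "size_list size ts" arbitrary: ts rule: less_induct)
  case less
  show ?case
  proof (cases ts)
    case Nil
    then show ?thesis by (simp add: reduces_to_def)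
  next
    case (Cons t rest)
    obtain H us where t: "t = Node H us" by (cases t)
    \<comment> \<open>Only \<open>rest\<close> is filtered: if \<open>H\<close> is among its own
      subgoals, the union with \<open>\<rho> H\<close> puts it back, so derivations of
      \<open>H\<close> in \<open>us\<close> must stay.\<close>
    define ts' where "ts' = us @ filter (\<lambda>u. concl u \<noteq> H) rest"
    have rule: "(map concl us, H) \<in> L" and ts': "list_all (derivation L) ts'"
      using less.prems by (auto simp: Cons t ts'_def list_all_iff)
    have in_goals: "concl ` set ts \<subseteq> \<GG>"
      using less.prems concl_in_goals[OF assms(1)] by (auto simp: list_all_iff)
    then have "H \<in> \<GG>"
      by (simp add: Cons t)
    with assms(2) rule obtain \<rho> where "\<rho> \<in> D" "\<rho> H = Some (set (map concl us))"
      unfolding adequate_def by blast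
    then have "\<rho> \<in> D" "\<rho> H = Some (concl ` set us)"
      by simp_all
    moreover have "H \<in> concl ` set ts"
      by (simp add: Cons t)
    moreover have "concl ` set ts' = (concl ` set ts - {H}) \<union> concl ` set us"
      by (auto simp: Cons t ts'_def)
    ultimately have step: "reduction_step \<GG> D (concl ` set ts) (concl ` set ts')"
      using in_goals unfolding reduction_step_def Fpow_def by blast
    have "size_list size (filter (\<lambda>u. concl u \<noteq> H) rest) \<le> size_list size rest"
      by (induction rest) auto
    \<comment> \<open>The root of \<open>t\<close> is lost, so the decrease is strict even when the
      filter discards nothing.\<close>
    then have "size_list size ts' < size_list size ts"
      by (simp add: Cons t ts'_def size_list_append)
    then have "reduces_to \<GG> D (concl ` set ts') {}"
      using less.hyps ts' by blast
    with step show ?thesis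
      unfolding reduces_to_def by (rule converse_rtranclp_into_rtranclp)
  qed
qed

theorem proposition11:
  fixes \<GG> :: "'g set" and V :: "'g logic" and L :: "'g rule set" and D :: "'g operator set"
  assumes "logic_over \<GG> V"
    and "deductive_system \<GG> L"
    and "sound_system \<GG> V L"
    and "complete_system \<GG> V L"
    and "finite D"
    and "\<forall>\<rho>\<in>D. reduction_operator \<GG> \<rho>"
  shows "(faithful \<GG> D L \<longrightarrow> sound_operators \<GG> V D) \<and>
         (adequate \<GG> D L \<longrightarrow> complete_operators \<GG> V D)"
proof (intro conjI impI)
  assume "faithful \<GG> D L"
  with assms(3) show "sound_operators \<GG> V D"
    unfolding sound_operators_def sound_system_def
    by (blast intro: reduces_to_empty_imp_admits_proof)
next
  assume adequate: "adequate \<GG> D L"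
  show "complete_operators \<GG> V D"
    unfolding complete_operators_def
  proof (intro ballI impI)
    fix G assume "G \<in> \<GG>" "G \<in> V"
    with assms(4) obtain t where "derivation L t" "concl t = G"
      unfolding complete_system_def admits_proof_def by blast
    then show "reduces_to \<GG> D {G} {}"
      using derivations_reduce_to_empty[OF assms(2) adequate, of "[t]"] by simp
  qed
qed

end
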